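(* Let $m$ be a positive even integer and let $e=2\cdot 3^{m-1}-3^{\frac{m}{2}-1}-1$. Then $\mathcal{C}_{(0,1,e)}$ is an optimal ternary cyclic code with parameters $[3^m-1,\ 3^m-\frac{3m}{2}-2,\ 4]$.
   Context: Let $m$ be a positive integer, $\mathbb{F}_{3^m}$ the finite field with $3^m$ elements, and $\alpha$ a generator of the multiplicative group $\mathbb{F}_{3^m}^*$. For an integer $i$, $m_{\alpha^i}(x)$ denotes the minimal polynomial of $\alpha^i$ over $\mathbb{F}_3$. An $[n,k,d]$ linear code over $\mathbb{F}_3$ is a $k$-dimensional subspace of $\mathbb{F}_3^n$ with minimum Hamming distance $d$. A ternary cyclic code of length $n$ (with $\gcd(n,3)=1$) is identified with an ideal of $\mathbb{F}_3[x]/(x^n-1)$ via $(c_0,\dots,c_{n-1})\mapsto c_0+c_1x+\cdots+c_{n-1}x^{n-1}$; its generator polynomial is the monic polynomial of least degree generating the ideal. $\mathcal{C}_{(i_1,i_2,\dots,i_t)}$ denotes the ternary cyclic code of length $3^m-1$ with generator polynomial $m_{\alpha^{i_1}}(x)m_{\alpha^{i_2}}(x)\cdots m_{\alpha^{i_t}}(x)$. A ternary $[n,k,d]$ code is optimal (in the standard sense) if no linear code over $\mathbb{F}_3$ of length $n$ and dimension $k$ has minimum distance larger than $d$. *)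

theory Defs
  imports
    "HOL-Algebra.QuotRing"
    "Jordan_Normal_Form.VS_Connect"
    "Berlekamp_Zassenhaus.Finite_Field"
begin

instance Enum.finite_3 :: prime_card
  by standard (simp add: UNIV_finite_3 flip: numeral_3_eq_3)

type_synonym gf3 = "Enum.finite_3 mod_ring"


text \<open>
  The map below is the embedding of the prime field whenever \<open>'a\<close> has characteristic 3;
  in other characteristics it is not a homomorphism and the definition is meaningless.
\<close>

definition gf3_embed :: "gf3 \<Rightarrow> 'a::field" where
  "gf3_embed c = of_int (to_int_mod_ring c)"

definition minimal_poly :: "'a::field \<Rightarrow> gf3 poly" where
  "minimal_poly a = (THE p. lead_coeff p = 1 \<and> poly (map_poly gf3_embed p) a = 0 \<and>
     (\<forall>q. q \<noteq> 0 \<and> poly (map_poly gf3_embed q) a = 0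
        \<longrightarrow> Polynomial.degree p \<le> Polynomial.degree q))"

definition generates_units :: "'a::field \<Rightarrow> bool" where
  "generates_units a \<longleftrightarrow> range (\<lambda>k::int. a powi k) = UNIV - {0}"


definition hamming_dist :: "'a vec \<Rightarrow> 'a vec \<Rightarrow> nat" where
  "hamming_dist x y = card {i. i < dim_vec x \<and> x $ i \<noteq> y $ i}"

text \<open>By the convention \<open>Inf {} = 0\<close> on \<open>nat\<close>, a code with a single word has minimum distance 0.\<close>

definition min_dist :: "'a vec set \<Rightarrow> nat" where
  "min_dist C = Inf {hamming_dist x y | x y. x \<in> C \<and> y \<in> C \<and> x \<noteq> y}"

definition linear_code :: "nat \<Rightarrow> nat \<Rightarrow> nat \<Rightarrow> gf3 vec set \<Rightarrow> bool" where
  "linear_code n k d C \<longleftrightarrow>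
     VectorSpace.subspace class_ring C (module_vec TYPE(gf3) n) \<and>
     vectorspace.dim class_ring ((module_vec TYPE(gf3) n)\<lparr>carrier := C\<rparr>) = k \<and>
     min_dist C = d"

definition optimal_code :: "nat \<Rightarrow> nat \<Rightarrow> nat \<Rightarrow> gf3 vec set \<Rightarrow> bool" where
  "optimal_code n k d C \<longleftrightarrow>
     linear_code n k d C \<and> (\<forall>D d'. linear_code n k d' D \<longrightarrow> d' \<le> d)"


text \<open>\<open>class_ring\<close> is the ring record of a type, here the polynomial ring over \<open>gf3\<close>.\<close>

definition cyclic_modulus :: "nat \<Rightarrow> gf3 poly set" where
  "cyclic_modulus n = PIdl\<^bsub>class_ring\<^esub> (Polynomial.monom 1 n - 1)"

definition cyclic_ring :: "nat \<Rightarrow> gf3 poly set ring" where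
  "cyclic_ring n = class_ring Quot cyclic_modulus n"

definition residue_class :: "nat \<Rightarrow> gf3 poly \<Rightarrow> gf3 poly set" where
  "residue_class n p = cyclic_modulus n +>\<^bsub>class_ring\<^esub> p"

definition word_poly :: "gf3 vec \<Rightarrow> gf3 poly" where
  "word_poly c = (\<Sum>i<dim_vec c. Polynomial.monom (c $ i) i)"

definition code_ideal :: "nat \<Rightarrow> gf3 vec set \<Rightarrow> gf3 poly set set" where
  "code_ideal n C = (\<lambda>c. residue_class n (word_poly c)) ` C"

definition cyclic_code :: "nat \<Rightarrow> gf3 vec set \<Rightarrow> bool" where
  "cyclic_code n C \<longleftrightarrow>
     coprime n 3 \<and> C \<subseteq> carrier_vec n \<and> ideal (code_ideal n C) (cyclic_ring n)"

definition is_generator_poly :: "nat \<Rightarrow> gf3 vec set \<Rightarrow> gf3 poly \<Rightarrow> bool" where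
  "is_generator_poly n C g \<longleftrightarrow>
     lead_coeff g = 1 \<and> PIdl\<^bsub>cyclic_ring n\<^esub> (residue_class n g) = code_ideal n C \<and>
     (\<forall>h. lead_coeff h = 1 \<and> PIdl\<^bsub>cyclic_ring n\<^esub> (residue_class n h) = code_ideal n C
        \<longrightarrow> Polynomial.degree g \<le> Polynomial.degree h)"

text \<open>
  The code of length \<open>CARD('a) - 1\<close> whose generator polynomial is the product of the minimal
  polynomials of the listed powers of \<open>a\<close>.  A generator polynomial determines its code, so
  the description is proper as soon as such a code exists; there is none when two of the
  listed powers are conjugate.
\<close>

definition cyclic_code_of :: "'a::field \<Rightarrow> int list \<Rightarrow> gf3 vec set" where
  "cyclic_code_of a is =
     (THE C. cyclic_code (CARD('a) - 1) C \<and>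
        is_generator_poly (CARD('a) - 1) C (\<Prod>i\<leftarrow>is. minimal_poly (a powi i)))"

end

(*
  Put q = 3^(m/2), so that the length is n = q^2 - 1. Since 3 e = 2 n - (q + 1), the element
  beta = alpha^e satisfies beta^3 = N(alpha)^(-1) with the norm N(x) = x * x^q. Hence beta has
  degree m/2 over F_3, the generator polynomial has degree 1 + m + m/2, and a word c lies in
  the code iff the sums of c_i, of c_i x_i and of c_i N(x_i)^(-1) vanish, where x_i = alpha^i.

  A word of weight 3 in the code would give distinct x, y = x + d, z = x - d with
  1/N(x) + 1/N(y) + 1/N(z) = 0. In characteristic 3 this says N(d)^2 = S^2 for
  S = x d^q - x^q d; since the q-power map fixes N(d) and negates S, it follows that d = 0.

  A code with the same length and dimension and with minimum distance 5 would violate the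
  sphere packing bound; the words of weight exactly 2 in the balls already suffice.
*)

theory Submission
  imports Defs
begin

section \<open>Evaluation of ternary polynomials\<close>

lemma CARD_finite_3 [simp]: "CARD(Enum.finite_3) = 3"
  by (simp add: UNIV_finite_3)

text \<open>Sums and products in \<open>gf3\<close> are integer ones reduced modulo 3, and in
  characteristic 3 \<open>of_int\<close> does not see that reduction.\<close>

lemma field_hom_gf3_embed:
  assumes "CHAR('a::field) = 3"
  shows "field_hom (gf3_embed :: gf3 \<Rightarrow> 'a)"
proof
  have of_int_mod: "(of_int (x mod 3) :: 'a) = of_int x" for x
    using of_int_mod_CHAR[where ?'a='a, of x] assms by simp
  show "gf3_embed (x + y) = (gf3_embed x + gf3_embed y :: 'a)" for x y :: gf3
    by (simp add: gf3_embed_def to_int_mod_ring_add of_int_mod)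
  show "gf3_embed (x * y) = (gf3_embed x * gf3_embed y :: 'a)" for x y :: gf3
    by (simp add: gf3_embed_def to_int_mod_ring_mult of_int_mod)
qed (simp_all add: gf3_embed_def)

text \<open>Names the expression inside \<open>minimal_poly\<close>, so that evaluation at a fixed
  point can be used as a ring homomorphism on \<open>gf3 poly\<close>.\<close>

definition gf3_eval :: "'a::field \<Rightarrow> gf3 poly \<Rightarrow> 'a" where
  "gf3_eval a p = poly (map_poly gf3_embed p) a"

lemma comm_ring_hom_gf3_eval:
  assumes "CHAR('a::field) = 3"
  shows "comm_ring_hom (gf3_eval (a::'a))"
proof -
  interpret field_hom "gf3_embed :: gf3 \<Rightarrow> 'a"
    using assms by (rule field_hom_gf3_embed)
  interpret M: map_poly_comm_ring_hom "gf3_embed :: gf3 \<Rightarrow> 'a" ..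
  show ?thesis
    by unfold_locales (simp_all add: gf3_eval_def hom_distribs)
qed

lemma gf3_eval_monom:
  assumes "CHAR('a::field) = 3"
  shows "gf3_eval (a::'a) (Polynomial.monom c i) = gf3_embed c * a ^ i"
proof -
  interpret field_hom "gf3_embed :: gf3 \<Rightarrow> 'a"
    using assms by (rule field_hom_gf3_embed)
  show ?thesis by (simp add: gf3_eval_def poly_monom)
qed

lemma gf3_eval_smult:
  assumes "CHAR('a::field) = 3"
  shows "gf3_eval (a::'a) (Polynomial.smult c p) = gf3_embed c * gf3_eval a p"
proof -
  interpret field_hom "gf3_embed :: gf3 \<Rightarrow> 'a"
    using assms by (rule field_hom_gf3_embed)
  show ?thesis by (simp add: gf3_eval_def hom_distribs)
qed

lemma gf3_embed_eq_0_iff: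
  assumes "CHAR('a::field) = 3"
  shows "gf3_embed c = (0::'a) \<longleftrightarrow> c = 0"
proof -
  interpret field_hom "gf3_embed :: gf3 \<Rightarrow> 'a"
    using assms by (rule field_hom_gf3_embed)
  show ?thesis by simp
qed


section \<open>Minimal polynomials\<close>

text \<open>Resolves the definite description. Some nonzero polynomial vanishing at \<open>a\<close>
  has least degree and can be made monic; two such differ by a polynomial that vanishes at
  \<open>a\<close> and whose leading terms cancel, hence by 0.\<close>

lemma minimal_poly_properties:
  fixes a :: "'a::field"
  assumes char: "CHAR('a) = 3" and q: "q \<noteq> 0" "gf3_eval a q = 0"
  shows lead_coeff_minimal_poly: "lead_coeff (minimal_poly a) = 1"
    and gf3_eval_minimal_poly: "gf3_eval a (minimal_poly a) = 0"
    and degree_minimal_poly_le: "\<And>r. r \<noteq> 0 \<Longrightarrow> gf3_eval a r = 0 \<Longrightarrow>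
      Polynomial.degree (minimal_poly a) \<le> Polynomial.degree r"
proof -
  interpret E: comm_ring_hom "gf3_eval a" using char by (rule comm_ring_hom_gf3_eval)
  define P where "P = (\<lambda>p. lead_coeff p = 1 \<and> gf3_eval a p = 0 \<and>
    (\<forall>q. q \<noteq> 0 \<and> gf3_eval a q = 0 \<longrightarrow> Polynomial.degree p \<le> Polynomial.degree q))"
  obtain r where r: "r \<noteq> 0" "gf3_eval a r = 0"
    "\<And>s. s \<noteq> 0 \<Longrightarrow> gf3_eval a s = 0 \<Longrightarrow> Polynomial.degree r \<le> Polynomial.degree s"
    using ex_has_least_nat[of "\<lambda>r. r \<noteq> 0 \<and> gf3_eval a r = 0" q Polynomial.degree] q by blast
  have "P (Polynomial.smult (inverse (lead_coeff r)) r)"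
    using r by (simp add: P_def gf3_eval_smult[OF char])
  moreover have "p = s" if "P p" "P s" for p s
  proof (rule ccontr)
    assume "p \<noteq> s"
    have deg: "Polynomial.degree p = Polynomial.degree s"
      by (metis P_def antisym that leading_coeff_0_iff zero_neq_one)
    have "gf3_eval a (p - s) = 0" using that by (simp add: P_def E.hom_minus)
    with \<open>p \<noteq> s\<close> that have "Polynomial.degree p \<le> Polynomial.degree (p - s)"
      by (simp add: P_def)
    moreover have "Polynomial.degree (p - s) \<le> Polynomial.degree p"
      using deg by (simp add: degree_diff_le)
    moreover have "Polynomial.coeff (p - s) (Polynomial.degree p) = 0"
      using that deg by (simp add: P_def)
    ultimately show False
      using \<open>p \<noteq> s\<close> by (metis antisym leading_coeff_0_iff right_minus_eq)
  qed
  ultimately have "\<exists>!p. P p" by blast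
  then have "P (THE p. P p)" by (rule theI')
  then have "P (minimal_poly a)"
    by (simp add: minimal_poly_def P_def gf3_eval_def)
  then show "lead_coeff (minimal_poly a) = 1" "gf3_eval a (minimal_poly a) = 0"
    "\<And>r. r \<noteq> 0 \<Longrightarrow> gf3_eval a r = 0 \<Longrightarrow>
      Polynomial.degree (minimal_poly a) \<le> Polynomial.degree r"
    by (auto simp: P_def)
qed

text \<open>A polynomial and its remainder modulo \<open>minimal_poly a\<close> agree at
  \<open>a\<close>, and a nonzero remainder vanishing there would have too small a degree. This
  translates membership in the code into equations in the field.\<close>

lemma minimal_poly_dvd_iff:
  fixes a :: "'a::field"
  assumes char: "CHAR('a) = 3" and q: "q \<noteq> 0" "gf3_eval a q = 0"
  shows "minimal_poly a dvd p \<longleftrightarrow> gf3_eval a p = 0"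
proof -
  interpret E: comm_ring_hom "gf3_eval a" using char by (rule comm_ring_hom_gf3_eval)
  note props = minimal_poly_properties[OF assms]
  have nz: "minimal_poly a \<noteq> 0" using props(1) by auto
  have "p mod minimal_poly a = 0" if "gf3_eval a p = 0"
  proof (rule ccontr)
    assume *: "p mod minimal_poly a \<noteq> 0"
    have "gf3_eval a p = gf3_eval a (p div minimal_poly a * minimal_poly a + p mod minimal_poly a)"
      by simp
    also have "\<dots> = gf3_eval a (p mod minimal_poly a)"
      by (simp only: E.hom_add E.hom_mult props(2)) simp
    finally have "gf3_eval a (p mod minimal_poly a) = 0" using that by simp
    with * props(3) degree_mod_less'[OF nz *] show False by force
  qed
  moreover have "gf3_eval a p = 0" if "minimal_poly a dvd p"
    using that props(2) by (auto elim!: dvdE simp: E.hom_mult)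
  ultimately show ?thesis by auto
qed

text \<open>Divisibility means vanishing at \<open>a\<close>, and a product in a field vanishes only
  with one of its factors.\<close>

lemma prime_elem_minimal_poly:
  fixes a :: "'a::field"
  assumes char: "CHAR('a) = 3" and q: "q \<noteq> 0" "gf3_eval a q = 0"
  shows "prime_elem (minimal_poly a)"
proof (rule prime_elemI)
  interpret E: comm_ring_hom "gf3_eval a" using char by (rule comm_ring_hom_gf3_eval)
  note props = minimal_poly_properties[OF assms]
  show "minimal_poly a \<noteq> 0" using props(1) by auto
  show "\<not> minimal_poly a dvd 1" by (simp only: minimal_poly_dvd_iff[OF assms] E.hom_one) simp
  show "minimal_poly a dvd r \<or> minimal_poly a dvd s" if "minimal_poly a dvd r * s" for r s
    using that by (simp add: minimal_poly_dvd_iff[OF assms] E.hom_mult)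
qed

text \<open>Multiplication by \<open>x\<close> permutes the nonzero elements, so their product
  absorbs the factor \<open>x ^ (CARD('a) - 1)\<close> unchanged and can be cancelled.\<close>

lemma power_card_units:
  fixes x :: "'a::{field, finite}"
  assumes "x \<noteq> 0"
  shows "x ^ (CARD('a) - 1) = 1"
proof -
  have "(\<Prod>y\<in>UNIV - {0}. y) = (\<Prod>y\<in>UNIV - {0}. x * y)"
    by (rule prod.reindex_bij_witness[of _ "\<lambda>y. x * y" "\<lambda>y. y / x"]) (use assms in auto)
  also have "\<dots> = x ^ (CARD('a) - 1) * (\<Prod>y\<in>UNIV - {0}. y)"
    by (simp add: prod.distrib card_Diff_subset)
  finally show ?thesis by (simp add: prod_zero_iff)
qed

text \<open>Exponents matter only modulo \<open>CARD('a) - 1\<close>, so the listed powers already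
  exhaust the nonzero elements; a surjection between finite sets of equal size is injective.\<close>

lemma generates_units_inj_on:
  fixes \<alpha> :: "'a::{field, finite}"
  assumes "generates_units \<alpha>"
  shows "\<alpha> \<noteq> 0" "inj_on (\<lambda>i. \<alpha> ^ i) {..<CARD('a) - 1}"
proof -
  have range: "range (\<lambda>k::int. \<alpha> powi k) = UNIV - {0}"
    using assms by (simp add: generates_units_def)
  then show "\<alpha> \<noteq> 0"
    by (metis DiffE insertI1 power_int_1_right rangeI)
  have n: "CARD('a) - 1 > 0"
    using card_mono[of UNIV "{0, 1 :: 'a}"] by simp
  have "\<alpha> powi k \<in> (\<lambda>i. \<alpha> ^ i) ` {..<CARD('a) - 1}" for k
  proof -
    define n where "n = int (CARD('a) - 1)"
    have "\<alpha> powi k = \<alpha> powi (n * (k div n) + k mod n)" by simp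
    also have "\<dots> = (\<alpha> powi n) powi (k div n) * \<alpha> powi (k mod n)"
      using \<open>\<alpha> \<noteq> 0\<close> by (subst power_int_add) (simp_all add: power_int_mult)
    also have "\<alpha> powi n = 1"
      using power_card_units[OF \<open>\<alpha> \<noteq> 0\<close>] unfolding n_def power_int_of_nat .
    also have "1 powi (k div n) * \<alpha> powi (k mod n) = \<alpha> ^ nat (k mod n)"
      using n by (simp add: power_int_def n_def)
    finally show ?thesis using n by (force simp: n_def nat_less_iff)
  qed
  then have "(\<lambda>i. \<alpha> ^ i) ` {..<CARD('a) - 1} = UNIV - {0}"
    using \<open>\<alpha> \<noteq> 0\<close> unfolding range[symmetric] by (auto simp flip: power_int_of_nat)
  then show "inj_on (\<lambda>i. \<alpha> ^ i) {..<CARD('a) - 1}"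
    by (intro eq_card_imp_inj_on) (simp_all add: card_Diff_subset)
qed

lemma gf3_eval_pCons:
  assumes "CHAR('a::field) = 3"
  shows "gf3_eval (a::'a) (pCons c p) = gf3_embed c + a * gf3_eval a p"
proof -
  interpret field_hom "gf3_embed :: gf3 \<Rightarrow> 'a"
    using assms by (rule field_hom_gf3_embed)
  show ?thesis by (simp add: gf3_eval_def map_poly_pCons_hom)
qed

text \<open>Cubing is additive in characteristic 3 and fixes every coefficient, so powers of
  Frobenius move from the value to the point.\<close>

lemma gf3_eval_power:
  assumes char: "CHAR('a::field) = 3"
  shows "gf3_eval (a::'a) p ^ 3 ^ k = gf3_eval (a ^ 3 ^ k) p"
proof (induction p)
  case 0
  then show ?case by (simp add: gf3_eval_def)
next
  case (pCons c p)
  interpret field_hom "gf3_embed :: gf3 \<Rightarrow> 'a"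
    using char by (rule field_hom_gf3_embed)
  have "c ^ 3 = c"
    using power_card_units[of c] by (cases "c = 0") (simp_all add: power3_eq_cube power2_eq_square)
  then have "c ^ 3 ^ k = c"
    by (induction k) (simp_all add: power_mult)
  then have "gf3_embed c ^ 3 ^ k = (gf3_embed c :: 'a)"
    by (simp flip: hom_power)
  moreover have "(x + y) ^ 3 ^ k = x ^ 3 ^ k + y ^ 3 ^ k" for x y :: 'a
    by (rule freshmans_dream') (simp_all add: char)
  ultimately show ?case
    by (simp add: gf3_eval_pCons[OF char] power_mult_distrib pCons.IH)
qed

section \<open>Words as polynomials of bounded degree\<close>

lemma card_carrier_vec: "card (carrier_vec n :: 'b::finite vec set) = CARD('b) ^ n"
  and finite_carrier_vec: "finite (carrier_vec n :: 'b vec set)"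
proof -
  have bij: "bij_betw (vec n) ({..<n} \<rightarrow>\<^sub>E (UNIV :: 'b set)) (carrier_vec n)"
    by (rule bij_betwI[where g = "\<lambda>v. restrict (($) v) {..<n}"])
      (auto simp: PiE_def extensional_def)
  show "card (carrier_vec n :: 'b vec set) = CARD('b) ^ n"
    unfolding bij_betw_same_card[OF bij, symmetric] by (simp add: card_PiE)
  show "finite (carrier_vec n :: 'b vec set)"
    unfolding bij_betw_finite[OF bij, symmetric] by (simp add: finite_PiE)
qed

lemma coeff_word_poly:
  "Polynomial.coeff (word_poly c) i = (if i < dim_vec c then c $ i else 0)"
  by (auto simp: word_poly_def coeff_sum if_distrib sum.delta)

lemma inj_on_word_poly: "inj_on word_poly (carrier_vec n)"
proof (rule inj_onI)
  fix c d assume "c \<in> carrier_vec n" "d \<in> carrier_vec n" "word_poly c = word_poly d"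
  then have "c $ i = d $ i" if "i < n" for i
    using coeff_word_poly[of c i] coeff_word_poly[of d i] that by simp
  with \<open>c \<in> carrier_vec n\<close> \<open>d \<in> carrier_vec n\<close> show "c = d" by (auto intro!: eq_vecI)
qed

lemma word_poly_image:
  "word_poly ` carrier_vec n = {p. \<forall>i\<ge>n. Polynomial.coeff p i = 0}"
proof (intro equalityI subsetI)
  fix p assume "p \<in> {p :: gf3 poly. \<forall>i\<ge>n. Polynomial.coeff p i = 0}"
  then have "p = word_poly (vec n (Polynomial.coeff p))"
    by (auto simp: poly_eq_iff coeff_word_poly)
  then show "p \<in> word_poly ` carrier_vec n" by (rule image_eqI) simp
qed (auto simp: coeff_word_poly)

text \<open>The condition on coefficients is preferred to a bare degree bound because the zero
  polynomial has degree 0, which is not below \<open>n\<close> when \<open>n = 0\<close>.\<close>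

lemma polys_below_iff:
  "(\<forall>i\<ge>n. Polynomial.coeff p i = 0) \<longleftrightarrow> p = 0 \<or> Polynomial.degree p < n"
proof
  assume *: "\<forall>i\<ge>n. Polynomial.coeff p i = 0"
  show "p = 0 \<or> Polynomial.degree p < n"
  proof (rule ccontr)
    assume "\<not> (p = 0 \<or> Polynomial.degree p < n)"
    with * have "lead_coeff p = 0" "p \<noteq> 0" by auto
    then show False by simp
  qed
qed (auto intro: coeff_eq_0)

lemma card_polys_below: "card {p :: gf3 poly. \<forall>i\<ge>n. Polynomial.coeff p i = 0} = 3 ^ n"
  unfolding word_poly_image[symmetric]
  by (simp add: card_image[OF inj_on_word_poly] card_carrier_vec)

lemma finite_polys_below: "finite {p :: gf3 poly. \<forall>i\<ge>n. Polynomial.coeff p i = 0}"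
  unfolding word_poly_image[symmetric] by (simp add: finite_carrier_vec)

text \<open>
  Two counts of the field \<open>F\<^sub>3[a]\<close>: all its elements are roots of \<open>x\<^bsup>3^k\<^esup> - x\<close>,
  so it has at most \<open>3\<^bsup>k\<^esup>\<close> elements, and it contains \<open>S\<close>.
\<close>

lemma degree_minimal_poly:
  fixes a :: "'a::field"
  assumes char: "CHAR('a) = 3" and k: "k > 0" "a ^ 3 ^ k = a"
    and S: "S \<subseteq> insert 0 (range (\<lambda>i. a ^ i))" "3 ^ (k - 1) < card S"
  shows "Polynomial.degree (minimal_poly a) = k"
proof -
  interpret E: comm_ring_hom "gf3_eval a" using char by (rule comm_ring_hom_gf3_eval)
  \<comment> \<open>This polynomial vanishes at \<open>a\<close> by assumption, so the minimal
    polynomial exists.\<close>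
  define q :: "gf3 poly" where "q = Polynomial.monom 1 (3 ^ k) - Polynomial.monom 1 1"
  have one_less: "1 < (3 :: nat) ^ k" using k by (intro one_less_power) simp_all
  have "Polynomial.coeff q (3 ^ k) = 1" using one_less by (simp add: q_def)
  then have "q \<noteq> 0" by auto
  moreover have embed1: "gf3_embed 1 = (1 :: 'a)" by (simp add: gf3_embed_def)
  then have "gf3_eval a q = 0" by (simp add: q_def E.hom_minus gf3_eval_monom[OF char] k)
  ultimately have q: "q \<noteq> 0" "gf3_eval a q = 0" by auto
  note props = minimal_poly_properties[OF char q]
  define d where "d = Polynomial.degree (minimal_poly a)"
  define P where "P = {p :: gf3 poly. \<forall>i\<ge>d. Polynomial.coeff p i = 0}"
  have nz: "minimal_poly a \<noteq> 0" using props(1) by auto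
  \<comment> \<open>Elements of F_3[a] have unique representatives of degree below \<open>d\<close>,
    so there are \<open>3 ^ d\<close> of them.\<close>
  have inj: "inj_on (gf3_eval a) P"
  proof (rule inj_onI, rule ccontr)
    fix p s assume ps: "p \<in> P" "s \<in> P" "gf3_eval a p = gf3_eval a s" "p \<noteq> s"
    then have "d \<le> Polynomial.degree (p - s)"
      unfolding d_def by (intro props(3)) (simp_all add: E.hom_minus)
    then have "Polynomial.coeff (p - s) (Polynomial.degree (p - s)) = 0"
      using ps by (simp add: P_def)
    with \<open>p \<noteq> s\<close> show False by (metis leading_coeff_0_iff right_minus_eq)
  qed
  have card: "card (gf3_eval a ` P) = 3 ^ d"
    using card_image[OF inj] by (simp add: P_def card_polys_below)
  have fin: "finite (gf3_eval a ` P)" by (simp add: P_def finite_polys_below)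
  \<comment> \<open>The same polynomial over the large field, where its roots are counted.\<close>
  define F where "F = Polynomial.monom 1 (3 ^ k) - (Polynomial.monom 1 1 :: 'a poly)"
  have "Polynomial.coeff F (3 ^ k) = 1" using one_less by (simp add: F_def)
  then have "F \<noteq> 0" by auto
  have "gf3_eval a ` P \<subseteq> {x. poly F x = 0}"
    using k(2) by (auto simp: F_def poly_monom gf3_eval_power[OF char])
  then have "card (gf3_eval a ` P) \<le> card {x. poly F x = 0}"
    using poly_roots_finite[OF \<open>F \<noteq> 0\<close>] by (intro card_mono)
  also have "\<dots> \<le> Polynomial.degree F"
    using \<open>F \<noteq> 0\<close> by (rule poly_roots_degree)
  also have "\<dots> \<le> 3 ^ k"
    unfolding F_def using one_less by (intro degree_diff_le) (auto simp: degree_monom_eq)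
  finally have "d \<le> k" using card by simp
  have reduce: "gf3_eval a p \<in> gf3_eval a ` P" for p
  proof (rule image_eqI)
    have "gf3_eval a p = gf3_eval a (p div minimal_poly a * minimal_poly a + p mod minimal_poly a)"
      by simp
    also have "\<dots> = gf3_eval a (p mod minimal_poly a)"
      by (simp only: E.hom_add E.hom_mult props(2)) simp
    finally show "gf3_eval a p = gf3_eval a (p mod minimal_poly a)" .
    show "p mod minimal_poly a \<in> P"
      using degree_mod_less[OF nz, of p] unfolding P_def d_def polys_below_iff by blast
  qed
  have "S \<subseteq> gf3_eval a ` P"
  proof
    fix x assume "x \<in> S"
    then consider "x = gf3_eval a 0" | i where "x = gf3_eval a (Polynomial.monom 1 i)"
      using S(1) embed1 by (auto simp: gf3_eval_monom[OF char])
    then show "x \<in> gf3_eval a ` P" using reduce by metis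
  qed
  then have "card S \<le> 3 ^ d" using card_mono[OF fin] card by simp
  \<comment> \<open>Sizes are powers of 3, so exceeding \<open>3 ^ (k - 1)\<close> is enough to
    force \<open>3 ^ k\<close>.\<close>
  with S(2) have "(3 :: nat) ^ (k - 1) < 3 ^ d" by (rule less_le_trans)
  then have "k - 1 < d" by simp
  with \<open>d \<le> k\<close> show ?thesis by (simp add: d_def)
qed

section \<open>Cyclic codes and generator polynomials\<close>

lemma cyclic_modulus_eq:
  "cyclic_modulus n = {p. (Polynomial.monom 1 n - 1) dvd p}"
  by (auto simp: cyclic_modulus_def cgenideal_def dvd_def mult.commute)

lemma ideal_cyclic_modulus: "ideal (cyclic_modulus n) class_ring"
  unfolding cyclic_modulus_def by (rule cring.cgenideal_ideal[OF class_cring.cring_axioms]) simp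

lemma cring_cyclic_ring: "cring (cyclic_ring n)"
  unfolding cyclic_ring_def
  by (rule ideal.quotient_is_cring[OF ideal_cyclic_modulus class_cring.cring_axioms])

lemma residue_class_eq:
  "residue_class n p = {r. (Polynomial.monom 1 n - 1) dvd (r - p)}"
proof -
  have "residue_class n p = (\<lambda>h. h + p) ` cyclic_modulus n"
    by (auto simp: residue_class_def a_r_coset_def r_coset_def)
  also have "\<dots> = {r. (Polynomial.monom 1 n - 1) dvd (r - p)}"
  proof (intro equalityI subsetI)
    fix r assume "r \<in> {r. (Polynomial.monom 1 n - 1) dvd (r - p)}"
    then show "r \<in> (\<lambda>h. h + p) ` cyclic_modulus n"
      by (intro image_eqI[of _ _ "r - p"]) (simp_all add: cyclic_modulus_eq)
  qed (auto simp: cyclic_modulus_eq)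
  finally show ?thesis .
qed

lemma residue_class_eq_iff:
  "residue_class n p = residue_class n r \<longleftrightarrow> (Polynomial.monom 1 n - 1) dvd (p - r)"
proof
  assume "residue_class n p = residue_class n r"
  moreover have "p \<in> residue_class n p" by (simp add: residue_class_eq)
  ultimately show "(Polynomial.monom 1 n - 1) dvd (p - r)" by (simp add: residue_class_eq)
next
  assume *: "(Polynomial.monom 1 n - 1) dvd (p - r)"
  have "(Polynomial.monom 1 n - 1) dvd (s - p) \<longleftrightarrow> (Polynomial.monom 1 n - 1) dvd (s - r)" for s
    using dvd_add_right_iff[OF *, of "s - p"] by (simp add: algebra_simps)
  then show "residue_class n p = residue_class n r" by (simp add: residue_class_eq)
qed

lemma carrier_cyclic_ring: "carrier (cyclic_ring n) = range (residue_class n)"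
  by (auto simp: cyclic_ring_def FactRing_def A_RCOSETS_def RCOSETS_def residue_class_def a_r_coset_def)

lemma mult_cyclic_ring:
  "residue_class n p \<otimes>\<^bsub>cyclic_ring n\<^esub> residue_class n r = residue_class n (p * r)"
  using ideal.rcoset_mult_add[OF ideal_cyclic_modulus, of p r]
  by (simp add: cyclic_ring_def FactRing_def residue_class_def)

lemma PIdl_residue_class:
  "PIdl\<^bsub>cyclic_ring n\<^esub> (residue_class n g) = residue_class n ` {p. g dvd p}"
proof -
  have "PIdl\<^bsub>cyclic_ring n\<^esub> (residue_class n g) =
      (\<lambda>r. residue_class n r \<otimes>\<^bsub>cyclic_ring n\<^esub> residue_class n g) ` UNIV"
    by (auto simp: cgenideal_def carrier_cyclic_ring)
  also have "\<dots> = residue_class n ` (\<lambda>r. r * g) ` UNIV"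
    by (simp only: mult_cyclic_ring image_image)
  also have "(\<lambda>r. r * g) ` UNIV = {p. g dvd p}"
    by (auto simp: dvd_def mult.commute)
  finally show ?thesis .
qed

text \<open>The explicit candidate for \<open>cyclic_code_of\<close>, described without the quotient
  ring.\<close>

definition generated_code :: "nat \<Rightarrow> gf3 poly \<Rightarrow> gf3 vec set" where
  "generated_code n g = {c \<in> carrier_vec n. g dvd word_poly c}"

lemma monom_minus_1_properties:
  assumes "n > 0"
  shows "Polynomial.degree (Polynomial.monom 1 n - 1 :: gf3 poly) = n"
    and "(Polynomial.monom 1 n - 1 :: gf3 poly) \<noteq> 0"
proof -
  have "Polynomial.degree (- 1 + Polynomial.monom 1 n :: gf3 poly) = n"
    using assms by (subst degree_add_eq_right) (simp_all add: degree_monom_eq)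
  then show *: "Polynomial.degree (Polynomial.monom 1 n - 1 :: gf3 poly) = n" by simp
  show "(Polynomial.monom 1 n - 1 :: gf3 poly) \<noteq> 0"
    using * assms by (metis Polynomial.degree_0 less_irrefl)
qed

text \<open>Every class has a representative of degree below \<open>n\<close>, and since
  \<open>g\<close> divides the modulus, reduction preserves divisibility by
  \<open>g\<close>.\<close>

lemma code_ideal_generated_code:
  assumes n: "n > 0" and g: "g dvd Polynomial.monom 1 n - 1"
  shows "code_ideal n (generated_code n g) = PIdl\<^bsub>cyclic_ring n\<^esub> (residue_class n g)"
  unfolding PIdl_residue_class
proof (intro equalityI subsetI)
  note X = monom_minus_1_properties[OF n]
  fix x assume "x \<in> residue_class n ` {p. g dvd p}"
  then obtain p where p: "g dvd p" "x = residue_class n p" by auto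
  define r where "r = p mod (Polynomial.monom 1 n - 1)"
  have "r \<in> word_poly ` carrier_vec n"
    using degree_mod_less[OF X(2), of p] X(1)
    unfolding word_poly_image r_def polys_below_iff by auto
  then obtain c where c: "c \<in> carrier_vec n" "word_poly c = r" by auto
  have "g dvd r" using p g by (simp add: r_def dvd_mod)
  moreover have "x = residue_class n r"
    by (simp add: p residue_class_eq_iff r_def minus_mod_eq_mult_div)
  ultimately show "x \<in> code_ideal n (generated_code n g)"
    using c by (auto simp: code_ideal_def generated_code_def)
qed (auto simp: code_ideal_def generated_code_def)

text \<open>Word polynomials have degree below \<open>n\<close>, so distinct words are never
  congruent modulo x^n - 1.\<close>

lemma code_ideal_inj:
  assumes n: "n > 0" and C: "C \<subseteq> carrier_vec n" "D \<subseteq> carrier_vec n"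
    and eq: "code_ideal n C = code_ideal n D"
  shows "C = D"
proof -
  note X = monom_minus_1_properties[OF n]
  have "inj_on (\<lambda>c. residue_class n (word_poly c)) (carrier_vec n)"
  proof (rule inj_onI)
    fix c d :: "gf3 vec"
    assume c: "c \<in> carrier_vec n" "d \<in> carrier_vec n"
      and "residue_class n (word_poly c) = residue_class n (word_poly d)"
    then have dvd: "(Polynomial.monom 1 n - 1) dvd (word_poly c - word_poly d)"
      by (simp add: residue_class_eq_iff)
    have "word_poly c - word_poly d = 0"
    proof (rule ccontr)
      assume nz: "word_poly c - word_poly d \<noteq> 0"
      then have "n \<le> Polynomial.degree (word_poly c - word_poly d)"
        using dvd_imp_degree_le[OF dvd nz] X by simp
      then have "Polynomial.coeff (word_poly c - word_poly d)
          (Polynomial.degree (word_poly c - word_poly d)) = 0"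
        using c by (simp add: coeff_word_poly)
      with nz show False by (metis leading_coeff_0_iff)
    qed
    then show "c = d" using inj_on_word_poly c by (auto dest: inj_onD)
  qed
  then show ?thesis
    using C eq unfolding code_ideal_def by (simp add: inj_on_image_eq_iff)
qed

text \<open>For the minimality of the degree: any other generator \<open>h\<close> is congruent to a
  multiple of \<open>g\<close>, and because \<open>g\<close> divides the modulus it divides
  \<open>h\<close> itself.\<close>

lemma generated_code_cyclic:
  assumes n: "n > 0" "coprime n 3" and g: "lead_coeff g = 1" "g dvd Polynomial.monom 1 n - 1"
  shows "cyclic_code n (generated_code n g)"
    and "is_generator_poly n (generated_code n g) g"
proof -
  interpret R: cring "cyclic_ring n" by (rule cring_cyclic_ring)
  note ideal = code_ideal_generated_code[OF n(1) g(2)]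
  show "cyclic_code n (generated_code n g)"
    unfolding cyclic_code_def ideal
  proof (intro conjI R.cgenideal_ideal)
    show "generated_code n g \<subseteq> carrier_vec n" by (auto simp: generated_code_def)
  qed (simp_all add: n carrier_cyclic_ring)
  show "is_generator_poly n (generated_code n g) g"
    unfolding is_generator_poly_def
  proof (intro conjI allI impI)
    fix h
    assume h: "lead_coeff h = 1 \<and>
      PIdl\<^bsub>cyclic_ring n\<^esub> (residue_class n h) = code_ideal n (generated_code n g)"
    then have "residue_class n ` {p. h dvd p} = residue_class n ` {p. g dvd p}"
      by (simp add: ideal PIdl_residue_class)
    moreover have "residue_class n h \<in> residue_class n ` {p. h dvd p}" by simp
    ultimately obtain r where r: "g dvd r" "residue_class n h = residue_class n r" by auto
    then have "g dvd h - r" using g(2) by (auto simp: residue_class_eq_iff intro: dvd_trans)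
    then have "g dvd (h - r) + r" using r(1) by (rule dvd_add)
    then show "Polynomial.degree g \<le> Polynomial.degree h"
      using h by (intro dvd_imp_degree_le) auto
  qed (simp_all add: g ideal)
qed

text \<open>A generator polynomial fixes the ideal and the ideal fixes the code, which gives the
  uniqueness required by the definite description.\<close>

lemma cyclic_code_of_eq:
  fixes a :: "'a::field" and "is" :: "int list"
  defines "n \<equiv> CARD('a) - 1" and "g \<equiv> (\<Prod>i\<leftarrow>is. minimal_poly (a powi i))"
  assumes n: "n > 0" "coprime n 3" and g: "lead_coeff g = 1" "g dvd Polynomial.monom 1 n - 1"
  shows "cyclic_code_of a is = generated_code n g"
  unfolding cyclic_code_of_def n_def[symmetric] g_def[symmetric]
proof (rule the_equality)
  show "cyclic_code n (generated_code n g) \<and> is_generator_poly n (generated_code n g) g"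
    using generated_code_cyclic[OF n g] by simp
  fix C assume "cyclic_code n C \<and> is_generator_poly n C g"
  then show "C = generated_code n g"
    using code_ideal_generated_code[OF n(1) g(2)]
    by (intro code_ideal_inj[OF n(1)])
      (auto simp: cyclic_code_def is_generator_poly_def generated_code_def)
qed

section \<open>Dimension and minimum distance\<close>

text \<open>Coordinates with respect to a basis identify vectors with functions from the basis to
  the scalars. Dimensions can thus be read off from cardinalities, for the code and for its
  competitors.\<close>

lemma (in vectorspace) card_carrier_eq_power_dim:
  assumes "finite (carrier V)"
  shows "card (carrier V) = card (carrier K) ^ dim"
proof -
  have "span (carrier V) = carrier V"
    using in_own_span[of "carrier V"] span_is_subset2[of "carrier V"] by auto
  then have "fin_dim" unfolding fin_dim_def using assms by blast
  then obtain B where B: "finite B" "basis B" using finite_basis_exists by blast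
  have carr: "B \<subseteq> carrier V" using B by (simp add: basis_def)
  have "bij_betw (\<lambda>a. lincomb a B) (B \<rightarrow>\<^sub>E carrier K) (carrier V)"
    unfolding bij_betw_def
  proof
    have uniq: "\<exists>!a. a \<in> B \<rightarrow>\<^sub>E carrier K \<and> lincomb a B = v" if "v \<in> carrier V" for v
      using basis_criterion[OF B(1) carr] B(2) that by blast
    have closed: "lincomb a B \<in> carrier V" if "a \<in> B \<rightarrow>\<^sub>E carrier K" for a
      using that carr by (intro lincomb_closed) auto
    show "inj_on (\<lambda>a. lincomb a B) (B \<rightarrow>\<^sub>E carrier K)"
      using uniq closed by (intro inj_onI) metis
    show "(\<lambda>a. lincomb a B) ` (B \<rightarrow>\<^sub>E carrier K) = carrier V"
      using uniq closed by blast
  qed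
  then have "card (carrier V) = card (B \<rightarrow>\<^sub>E carrier K)"
    by (metis bij_betw_same_card)
  also have "\<dots> = card (carrier K) ^ dim"
    using B(1) by (simp add: card_PiE dim_basis[OF B])
  finally show ?thesis .
qed

lemma card_subspace:
  assumes "VectorSpace.subspace class_ring C (module_vec TYPE(gf3) n)"
  shows "card C = 3 ^ vectorspace.dim class_ring ((module_vec TYPE(gf3) n)\<lparr>carrier := C\<rparr>)"
proof -
  interpret V: vec_space "TYPE(gf3)" n .
  have "vectorspace class_ring ((module_vec TYPE(gf3) n)\<lparr>carrier := C\<rparr>)"
    using V.subspace_is_vs[OF assms] .
  moreover have "C \<subseteq> carrier_vec n"
    using submodule.subset assms by (fastforce simp: VectorSpace.subspace_def module_vec_simps)
  then have "finite C" using finite_carrier_vec finite_subset by blast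
  ultimately show ?thesis
    using vectorspace.card_carrier_eq_power_dim by fastforce
qed

lemma word_poly_add:
  "c \<in> carrier_vec n \<Longrightarrow> d \<in> carrier_vec n \<Longrightarrow> word_poly (c + d) = word_poly c + word_poly d"
  by (auto simp: poly_eq_iff coeff_word_poly)

lemma word_poly_minus:
  "c \<in> carrier_vec n \<Longrightarrow> d \<in> carrier_vec n \<Longrightarrow> word_poly (c - d) = word_poly c - word_poly d"
  by (auto simp: poly_eq_iff coeff_word_poly)

lemma word_poly_smult: "word_poly (a \<cdot>\<^sub>v c) = Polynomial.smult a (word_poly c)"
  by (auto simp: poly_eq_iff coeff_word_poly)

lemma word_poly_zero: "word_poly (0\<^sub>v n) = 0"
  by (auto simp: poly_eq_iff coeff_word_poly)

lemma subspace_generated_code: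
  "VectorSpace.subspace class_ring (generated_code n g) (module_vec TYPE(gf3) n)"
proof -
  interpret V: vec_space "TYPE(gf3)" n .
  have "submodule class_ring (generated_code n g) (module_vec TYPE(gf3) n)"
    by (intro submodule.intro V.module_axioms)
      (auto simp: generated_code_def module_vec_simps word_poly_add word_poly_smult word_poly_zero
        intro: dvd_add dvd_smult)
  then show ?thesis
    using V.vectorspace_axioms by (simp add: VectorSpace.subspace_def)
qed

text \<open>Multiplication by \<open>g\<close> maps the polynomials with \<open>n - degree g\<close>
  free coefficients bijectively onto the word polynomials of the code. If \<open>degree g\<close> is
  at least \<open>n\<close>, the truncated difference is 0 and only the zero word remains.\<close>

lemma card_generated_code:
  assumes g: "g \<noteq> 0"
  shows "card (generated_code n g) = 3 ^ (n - Polynomial.degree g)"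
proof -
  have "word_poly ` generated_code n g = {f \<in> word_poly ` carrier_vec n. g dvd f}"
    by (auto simp: generated_code_def)
  also have "\<dots> = (\<lambda>p. g * p) ` {p. \<forall>i\<ge>n - Polynomial.degree g. Polynomial.coeff p i = 0}"
  proof (intro equalityI subsetI)
    fix f assume "f \<in> {f \<in> word_poly ` carrier_vec n. g dvd f}"
    then have f: "f = 0 \<or> Polynomial.degree f < n" and "g dvd f"
      unfolding word_poly_image polys_below_iff by auto
    then obtain p where p: "f = g * p" by (elim dvdE)
    with f have "p = 0 \<or> Polynomial.degree p < n - Polynomial.degree g"
      using g by (cases "p = 0") (auto simp: degree_mult_eq)
    then show "f \<in> (\<lambda>p. g * p) ` {p. \<forall>i\<ge>n - Polynomial.degree g. Polynomial.coeff p i = 0}"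
      unfolding polys_below_iff p by blast
  next
    fix f assume "f \<in> (\<lambda>p. g * p) ` {p. \<forall>i\<ge>n - Polynomial.degree g. Polynomial.coeff p i = 0}"
    then obtain p where p: "f = g * p" "p = 0 \<or> Polynomial.degree p < n - Polynomial.degree g"
      unfolding polys_below_iff by blast
    then have "f = 0 \<or> Polynomial.degree f < n"
      using g by (cases "p = 0") (auto simp: degree_mult_eq)
    then show "f \<in> {f \<in> word_poly ` carrier_vec n. g dvd f}"
      unfolding word_poly_image polys_below_iff using p(1) by simp
  qed
  finally have "card (word_poly ` generated_code n g) =
      card {p :: gf3 poly. \<forall>i\<ge>n - Polynomial.degree g. Polynomial.coeff p i = 0}"
    using g by (simp add: card_image inj_on_def)
  moreover have "inj_on word_poly (generated_code n g)"
    using inj_on_word_poly by (rule inj_on_subset) (auto simp: generated_code_def)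
  ultimately show ?thesis by (simp add: card_image card_polys_below)
qed

section \<open>Minimum distance and sphere packing\<close>

lemma hamming_dist_ge_min_dist:
  "c \<in> C \<Longrightarrow> d \<in> C \<Longrightarrow> c \<noteq> d \<Longrightarrow> min_dist C \<le> hamming_dist c d"
  unfolding min_dist_def by (rule wellorder_Inf_le1) blast

text \<open>The two distinct words keep the set of distances nonempty, as the infimum of the empty
  set is 0.\<close>

lemma min_dist_geI:
  assumes "c \<in> C" "d \<in> C" "c \<noteq> d"
    and "\<And>x y. x \<in> C \<Longrightarrow> y \<in> C \<Longrightarrow> x \<noteq> y \<Longrightarrow> k \<le> hamming_dist x y"
  shows "k \<le> min_dist C"
  unfolding min_dist_def using assms by (intro cInf_greatest) blast+

text \<open>The Hamming ball of radius 2 around the zero word.\<close>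

definition low_weight_words :: "nat \<Rightarrow> gf3 vec set" where
  "low_weight_words n = {b \<in> carrier_vec n. card {i. i < n \<and> b $ i \<noteq> 0} \<le> 2}"

text \<open>Only weight exactly 2 is counted: n(n-1)/2 pairs of positions \<open>i < j\<close>, with
  4 choices of the two nonzero entries.\<close>

lemma card_low_weight_words: "2 * n * (n - 1) \<le> card (low_weight_words n)"
proof -
  define U :: "gf3 set" where "U = UNIV - {0}"
  define T where "T = (SIGMA j:{..<n}. {..<j}) \<times> U \<times> U"
  define f :: "(nat \<times> nat) \<times> gf3 \<times> gf3 \<Rightarrow> gf3 vec" where
    "f = (\<lambda>((j, i), a, b). vec n (\<lambda>k. if k = i then a else if k = j then b else 0))"
  have supp: "{k. k < n \<and> f ((j, i), a, b) $ k \<noteq> 0} = {i, j}"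
    if "((j, i), a, b) \<in> T" for i j a b
    using that by (auto simp: T_def U_def f_def split: if_splits)
  have "inj_on f T"
  proof (rule inj_onI)
    fix s t assume st: "s \<in> T" "t \<in> T" "f s = f t"
    obtain j i a b where s: "s = ((j, i), a, b)" by (metis surj_pair)
    obtain j' i' a' b' where t: "t = ((j', i'), a', b')" by (metis surj_pair)
    have ij: "i < j" "j < n" "i' < j'" "j' < n" using st s t by (auto simp: T_def)
    have "{i, j} = {i', j'}"
      using supp[of j i a b] supp[of j' i' a' b'] st by (simp add: s t)
    then have eq: "i = i'" "j = j'" using ij by (auto simp: doubleton_eq_iff)
    have "f s $ i = a" "f s $ j = b" "f t $ i = a'" "f t $ j = b'"
      using ij by (auto simp: s t f_def eq)
    then show "s = t" using st(3) by (simp add: s t eq)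
  qed
  moreover have "f ` T \<subseteq> low_weight_words n"
  proof
    fix v assume "v \<in> f ` T"
    then obtain j i a b where t: "((j, i), a, b) \<in> T" "v = f ((j, i), a, b)"
      by (metis (no_types, opaque_lifting) imageE surj_pair)
    have "v \<in> carrier_vec n" by (simp add: t f_def)
    moreover have "card {k. k < n \<and> v $ k \<noteq> 0} \<le> 2"
      unfolding t(2) supp[OF t(1)] by (simp add: card_insert_if)
    ultimately show "v \<in> low_weight_words n" by (simp add: low_weight_words_def)
  qed
  moreover have "finite (low_weight_words n)"
    by (rule finite_subset[of _ "carrier_vec n"]) (auto simp: low_weight_words_def finite_carrier_vec)
  ultimately have "card T \<le> card (low_weight_words n)" by (rule card_inj_on_le)
  moreover have "card U = 2" by (simp add: U_def card_Diff_subset)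
  then have "card T = 4 * \<Sum>{..<n}"
    by (simp add: T_def card_cartesian_product)
  moreover have "2 * \<Sum>{..<n} = n * (n - 1)"
    by (induction n) (auto simp: algebra_simps)
  ultimately show ?thesis by simp
qed

text \<open>With minimum distance at least 5 the balls of radius 2 around code words are disjoint,
  so they cannot hold more than \<open>3 ^ n\<close> words in total.\<close>

lemma min_dist_le_4:
  fixes D :: "gf3 vec set"
  assumes D: "D \<subseteq> carrier_vec n" and card: "3 ^ n < card D * (2 * n * (n - 1))"
  shows "min_dist D \<le> 4"
proof (rule ccontr)
  assume "\<not> min_dist D \<le> 4"
  then have dist: "4 < hamming_dist c d" if "c \<in> D" "d \<in> D" "c \<noteq> d" for c d
    using hamming_dist_ge_min_dist[OF that] by simp
  define B where "B = low_weight_words n"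
  have B: "b \<in> carrier_vec n" "card {i. i < n \<and> b $ i \<noteq> 0} \<le> 2" if "b \<in> B" for b
    using that by (auto simp: B_def low_weight_words_def)
  have "inj_on (\<lambda>(c, b). c + b) (D \<times> B)"
  proof (rule inj_onI, clarify)
    fix c b c' b' assume cb: "c \<in> D" "b \<in> B" "c' \<in> D" "b' \<in> B" "c + b = c' + b'"
    have carr: "c \<in> carrier_vec n" "c' \<in> carrier_vec n" using cb D by auto
    have eq: "c $ i + b $ i = c' $ i + b' $ i" if "i < n" for i
      using arg_cong[OF cb(5), of "\<lambda>v. v $ i"] that carr B(1)[OF cb(2)] B(1)[OF cb(4)] by simp
    have "c = c'"
    proof (rule ccontr)
      assume "c \<noteq> c'"
      \<comment> \<open>Two code words with a common point in their balls differ only on the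
        supports of \<open>b\<close> and \<open>b'\<close>, hence in at most 4 places.\<close>
      have "{i. i < n \<and> c $ i \<noteq> c' $ i} \<subseteq> {i. i < n \<and> b $ i \<noteq> 0} \<union> {i. i < n \<and> b' $ i \<noteq> 0}"
        using eq by fastforce
      then have "card {i. i < n \<and> c $ i \<noteq> c' $ i} \<le>
          card ({i. i < n \<and> b $ i \<noteq> 0} \<union> {i. i < n \<and> b' $ i \<noteq> 0})"
        by (intro card_mono) auto
      also have "\<dots> \<le> 2 + 2"
        using B(2)[OF cb(2)] B(2)[OF cb(4)] by (intro order.trans[OF card_Un_le] add_mono)
      finally have "hamming_dist c c' \<le> 4" using carr by (simp add: hamming_dist_def)
      with dist[OF cb(1,3) \<open>c \<noteq> c'\<close>] show False by simp
    qed
    moreover have "b = b'"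
      using eq B(1)[OF cb(2)] B(1)[OF cb(4)] \<open>c = c'\<close> by (intro eq_vecI) auto
    ultimately show "c = c' \<and> b = b'" ..
  qed
  moreover have "(\<lambda>(c, b). c + b) ` (D \<times> B) \<subseteq> carrier_vec n"
    using D B by auto
  ultimately have "card (D \<times> B) \<le> card (carrier_vec n :: gf3 vec set)"
    by (rule card_inj_on_le) (rule finite_carrier_vec)
  then have "card D * card B \<le> 3 ^ n"
    by (simp add: card_cartesian_product card_carrier_vec)
  moreover have "card D * (2 * n * (n - 1)) \<le> card D * card B"
    unfolding B_def by (intro mult_le_mono2 card_low_weight_words)
  ultimately show False using card by linarith
qed

section \<open>The code with zeros 1, alpha and alpha to the e\<close>

text \<open>Excludes words of weight 3. In the application \<open>\<sigma>\<close> is the q-power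
  map, the involution of the field over its subfield of \<open>q\<close> elements, and
  \<open>x * \<sigma> x\<close> is the norm.\<close>

lemma no_three_term_relation:
  fixes \<sigma> :: "'a::field \<Rightarrow> 'a"
  assumes char: "CHAR('a) = 3"
    and add: "\<And>x y. \<sigma> (x + y) = \<sigma> x + \<sigma> y" and mult: "\<And>x y. \<sigma> (x * y) = \<sigma> x * \<sigma> y"
    and invol: "\<And>x. \<sigma> (\<sigma> x) = x"
    and nz: "x \<noteq> 0" "y \<noteq> 0" "z \<noteq> 0" and "x \<noteq> y" and sum: "x + y + z = 0"
    and inv: "inverse (x * \<sigma> x) + inverse (y * \<sigma> y) + inverse (z * \<sigma> z) = 0"
  shows False
proof -
  have three: "u + u + u = 0" for u :: 'a
  proof -
    have "(of_nat 3 :: 'a) = 0" using of_nat_CHAR[where ?'a = 'a] by (simp only: char)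
    then have "(3 :: 'a) = 0" by simp
    moreover have "u + u + u = 3 * u" by simp
    ultimately show ?thesis by simp
  qed
  have "\<sigma> 0 + \<sigma> 0 = \<sigma> 0 + 0" using add[of 0 0] by (simp only: add_0_left add_0_right)
  then have \<sigma>0: "\<sigma> 0 = 0" by (rule add_left_imp_eq)
  have neg: "\<sigma> (- u) = - \<sigma> u" for u
    using add[of u "- u"] \<sigma>0 by (simp add: eq_neg_iff_add_eq_0 add.commute)
  have \<sigma>_nz: "\<sigma> u \<noteq> 0" if "u \<noteq> 0" for u using that invol[of u] \<sigma>0 by metis
  define d X D where "d = y - x" and "X = \<sigma> x" and "D = \<sigma> d"
  have y: "y = x + d" by (simp add: d_def)
  \<comment> \<open>From \<open>x + y + z = 0\<close> one gets z = -2x - d, and -2 = 1 in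
    characteristic 3.\<close>
  have z: "z = x - d"
  proof -
    have "z = (x + y + z) - (x + x + x) + (x - d)" by (simp add: y algebra_simps)
    then show ?thesis by (simp only: sum three) simp
  qed
  have \<sigma>y: "\<sigma> y = X + D" by (simp add: y add X_def D_def)
  have \<sigma>z: "\<sigma> z = X - D" using add[of x "- d"] by (simp add: z neg X_def D_def)
  define S where "S = x * D - d * X"
  have clear: "b * c + a * c + a * b = 0" if "inverse a + inverse b + inverse c = 0"
    "a \<noteq> 0" "b \<noteq> 0" "c \<noteq> 0" for a b c :: 'a
    using that by (simp add: field_simps)
  have "((x + d) * (X + D)) * ((x - d) * (X - D)) + (x * X) * ((x - d) * (X - D))
      + (x * X) * ((x + d) * (X + D)) = 0"
  proof (rule clear)
    show "inverse (x * X) + inverse ((x + d) * (X + D)) + inverse ((x - d) * (X - D)) = 0"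
      using inv unfolding \<sigma>y \<sigma>z unfolding y z X_def[symmetric] .
    show "x * X \<noteq> 0" "(x + d) * (X + D) \<noteq> 0" "(x - d) * (X - D) \<noteq> 0"
      using nz \<sigma>_nz[OF nz(1)] \<sigma>_nz[OF nz(2)] \<sigma>_nz[OF nz(3)]
      unfolding \<sigma>y \<sigma>z unfolding y z X_def[symmetric] by simp_all
  qed
  \<comment> \<open>Expanding the cleared equation leaves exactly this over any commutative ring;
    characteristic 3 then removes the bracket.\<close>
  then have "(d * D) * (d * D) - S * S + (x * x * X * X + x * x * X * X + x * x * X * X) = 0"
    unfolding S_def by (simp add: algebra_simps)
  then have "(d * D - S) * (d * D + S) = 0"
    unfolding three by (simp add: algebra_simps)
  moreover have "\<sigma> (d * D) = d * D" by (simp add: mult D_def invol mult.commute)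
  moreover have "\<sigma> S = - S"
    using add[of "x * D" "- (d * X)"] by (simp add: S_def neg mult invol D_def X_def mult.commute)
  \<comment> \<open>Applying \<open>\<sigma>\<close> to either equation fixes the left side and
    negates the right side.\<close>
  ultimately have "S = - S" if "d * D = S \<or> d * D = - S"
    using that by (metis neg minus_minus)
  moreover have "d * D = S \<or> d * D = - S"
    using \<open>(d * D - S) * (d * D + S) = 0\<close> by (simp add: eq_neg_iff_add_eq_0)
  ultimately have "S + S = 0" "d * D = S \<or> d * D = - S" by (simp_all add: eq_neg_iff_add_eq_0)
  \<comment> \<open>Both 2S and 3S vanish, so \<open>S = 0\<close>.\<close>
  with three[of S] have "d * D = 0" by auto
  then have "d = 0" using \<sigma>_nz[of d] by (auto simp: D_def)
  with \<open>x \<noteq> y\<close> show False by (simp add: d_def)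
qed

text \<open>The sum runs over the support only, so that a word of small weight gives an equation
  with few terms.\<close>

lemma gf3_eval_word_poly:
  assumes char: "CHAR('a::field) = 3" and u: "u \<in> carrier_vec n"
  shows "gf3_eval (a::'a) (word_poly u) = (\<Sum>i | i < n \<and> u $ i \<noteq> 0. gf3_embed (u $ i) * a ^ i)"
proof -
  interpret E: comm_ring_hom "gf3_eval a" using char by (rule comm_ring_hom_gf3_eval)
  have "gf3_eval a (word_poly u) = (\<Sum>i<n. gf3_embed (u $ i) * a ^ i)"
    using u by (simp add: word_poly_def E.hom_sum gf3_eval_monom[OF char])
  also have "\<dots> = (\<Sum>i | i < n \<and> u $ i \<noteq> 0. gf3_embed (u $ i) * a ^ i)"
    by (rule sum.mono_neutral_right) (auto simp: gf3_embed_eq_0_iff[OF char])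
  finally show ?thesis .
qed

lemma gf3_embed_cases:
  assumes char: "CHAR('a::field) = 3" and "c \<noteq> 0"
  shows "gf3_embed c = (1::'a) \<or> gf3_embed c = (- 1 :: 'a)"
proof -
  interpret field_hom "gf3_embed :: gf3 \<Rightarrow> 'a"
    using char by (rule field_hom_gf3_embed)
  have "c ^ 2 = 1" using power_card_units[OF \<open>c \<noteq> 0\<close>] by simp
  then have "gf3_embed c ^ 2 = (1::'a)" by (simp flip: hom_power)
  then show ?thesis by (simp add: power2_eq_1_iff)
qed

text \<open>The zero at 1 rules out weight 1. For weight 2 it makes the entries opposite, and the
  zero at \<open>\<alpha>\<close> then identifies the two positions. Weight 3 needs the inverse
  norms as well.\<close>

lemma weight_ge_4:
  fixes \<alpha> :: "'a::field"
  assumes char: "CHAR('a) = 3" and q: "q = 3 ^ h" "\<And>x :: 'a. (x ^ q) ^ q = x"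
    and \<alpha>: "\<alpha> \<noteq> 0" "inj_on (\<lambda>i. \<alpha> ^ i) {..<n}"
    and u: "u \<in> carrier_vec n" "u \<noteq> 0\<^sub>v n"
    and eval: "gf3_eval 1 (word_poly u) = (0::'a)" "gf3_eval \<alpha> (word_poly u) = 0"
      "gf3_eval (inverse (\<alpha> * \<alpha> ^ q)) (word_poly u) = 0"
  shows "4 \<le> card {i. i < n \<and> u $ i \<noteq> 0}"
proof (rule ccontr)
  define I where "I = {i. i < n \<and> u $ i \<noteq> 0}"
  define w :: "nat \<Rightarrow> 'a" where "w i = gf3_embed (u $ i)" for i
  define x where "x i = \<alpha> ^ i" for i
  define y where "y i = inverse (x i * x i ^ q)" for i
  have w: "w i = 1 \<or> w i = - 1" if "i \<in> I" for i
    using gf3_embed_cases[OF char] that by (simp add: w_def I_def)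
  have w_nz: "w i \<noteq> 0" if "i \<in> I" for i using w[OF that] by auto
  have x_nz: "x i \<noteq> 0" for i using \<alpha>(1) by (simp add: x_def)
  have x_inj: "x i \<noteq> x j" if "i \<in> I" "j \<in> I" "i \<noteq> j" for i j
    using inj_onD[OF \<alpha>(2)] that by (auto simp: x_def I_def)
  have sums: "(\<Sum>i\<in>I. w i) = 0" "(\<Sum>i\<in>I. w i * x i) = 0" "(\<Sum>i\<in>I. w i * y i) = 0"
    using eval unfolding gf3_eval_word_poly[OF char u(1)] I_def[symmetric]
    by (simp_all add: w_def x_def y_def power_mult_distrib power_inverse mult.commute flip: power_mult)
  have [simp]: "finite I" by (simp add: I_def)
  assume "\<not> 4 \<le> card {i. i < n \<and> u $ i \<noteq> 0}"
  then consider "card I = 0" | "card I = 1" | "card I = 2" | "card I = 3"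
    unfolding I_def[symmetric] by linarith
  then show False
  proof cases
    case 1
    then have "u $ i = 0" if "i < n" for i using that by (auto simp: I_def)
    then have "u = 0\<^sub>v n" using u(1) by (intro eq_vecI) auto
    with u(2) show False by simp
  next
    case 2
    then obtain i where "I = {i}" by (auto simp: card_1_singleton_iff)
    with sums(1) w_nz show False by simp
  next
    case 3
    then obtain i j where I: "I = {i, j}" "i \<noteq> j" by (auto simp: card_2_iff)
    have "w j = - w i" using sums(1) I by (simp add: add_eq_0_iff)
    then have "w i * (x i - x j) = 0" using sums(2) I by (simp add: algebra_simps)
    with w_nz[of i] x_inj[of i j] I show False by simp
  next
    case 4
    then obtain i j k where I: "I = {i, j, k}" "i \<noteq> j" "j \<noteq> k" "i \<noteq> k" by (auto simp: card_3_iff)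
    have expand: "(\<Sum>l\<in>I. f l) = f i + f j + f k" for f :: "nat \<Rightarrow> 'a"
      using I by (simp add: add.assoc)
    have "w i + w j + w k = 0" using sums(1) expand[of w] by simp
    \<comment> \<open>Three signs that are not all equal add up to 1 or -1.\<close>
    then have eq: "w j = w i" "w k = w i"
      using w[of i] w[of j] w[of k] I(1) by auto
    have "w i * (x i + x j + x k) = 0" "w i * (y i + y j + y k) = 0"
      using sums(2,3) unfolding expand eq by (simp_all add: algebra_simps)
    then have sum3: "x i + x j + x k = 0" "y i + y j + y k = 0"
      using w_nz[of i] I(1) by auto
    show False
    proof (rule no_three_term_relation[OF char, where \<sigma> = "\<lambda>z. z ^ q"])
      show "(a + b) ^ q = a ^ q + b ^ q" for a b :: 'a
        by (rule freshmans_dream') (simp_all add: char q)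
      show "(a * b) ^ q = a ^ q * b ^ q" for a b :: 'a
        by (rule power_mult_distrib)
      show "(a ^ q) ^ q = a" for a :: 'a by (rule q(2))
      show "x i \<noteq> 0" "x j \<noteq> 0" "x k \<noteq> 0" by (rule x_nz)+
      show "x i \<noteq> x j" using x_inj I by blast
    qed (use sum3 in \<open>simp_all add: y_def\<close>)
  qed
qed

text \<open>The numerical violation of the packing bound for length \<open>q * q - 1\<close> and
  redundancy \<open>3 * h + 1\<close>, where \<open>3 ^ (3 * h + 1)\<close> is
  \<open>3 * q ^ 3\<close>.\<close>

lemma square_bounds:
  fixes q :: nat
  assumes "3 \<le> q"
  shows "3 * q ^ 3 < 2 * (q * q - 1) * (q * q - 1 - 1)"
proof -
  obtain r where r: "q = r + 3" using assms by (metis le_add_diff_inverse2)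
  \<comment> \<open>This \<open>n\<close> is q^2 - 2. Writing \<open>q = r + 3\<close> removes
    truncated subtraction, and the two sides compare coefficient by coefficient in
    \<open>r\<close>.\<close>
  define n where "n = r * r + 6 * r + 7"
  have n: "q * q - 1 = n + 1" by (simp add: r n_def algebra_simps)
  show ?thesis unfolding n by (simp add: r n_def algebra_simps power3_eq_cube)
qed

theorem theorem1:
  fixes m :: nat and e :: int and \<alpha> :: "'a::{field, finite}"
  assumes "m > 0" and "even m"
    and "CARD('a) = 3 ^ m"
    and "generates_units \<alpha>"
    and "e = 2 * 3 ^ (m - 1) - 3 ^ (m div 2 - 1) - 1"
  shows "cyclic_code (3 ^ m - 1) (cyclic_code_of \<alpha> [0, 1, e]) \<and>
    optimal_code (3 ^ m - 1) (3 ^ m - 3 * m div 2 - 2) 4 (cyclic_code_of \<alpha> [0, 1, e])"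
proof -
  define h where "h = m div 2"
  define q :: nat where "q = 3 ^ h"
  define n where "n = CARD('a) - 1"
  define \<beta> where "\<beta> = \<alpha> powi e"
  have m: "m = 2 * h" and h: "h > 0" using assms(1,2) by (auto simp: h_def)
  have card: "CARD('a) = q * q" using assms(3) by (simp add: m q_def mult_2 power_add)
  have "h = Suc (h - 1)" using h by simp
  then have "q = 3 * 3 ^ (h - 1)" unfolding q_def by (metis power_Suc)
  then have q3: "3 \<le> q" by simp
  have "3 * q \<le> q * q" using q3 by simp
  moreover have "h < q" unfolding q_def by (rule less_exp[THEN order.strict_trans2]) (simp add: power_mono)
  \<comment> \<open>Makes the later difference \<open>n - (3 * h + 1)\<close> a genuine, positive
    dimension.\<close>
  ultimately have hn: "3 * h + 1 < n" using q3 unfolding n_def card by linarith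
  have n: "n = (q + 1) * (q - 1)" by (simp add: n_def card algebra_simps)
  have n_eq: "3 ^ m - 1 = n" using assms(3) by (simp add: n_def)
  have "\<not> 3 dvd n"
  proof
    assume "3 dvd n"
    moreover have "3 dvd n + 1"
      using \<open>q = 3 * 3 ^ (h - 1)\<close> q3 by (simp add: n_def card)
    ultimately show False by (metis dvd_add_right_iff nat_dvd_1_iff_1 numeral_eq_one_iff semiring_norm(86))
  qed
  then have "coprime 3 n" using prime_imp_coprime[of "3 :: nat" n] by simp
  then have cop: "coprime n 3" by (simp add: coprime_commute)
  have char: "CHAR('a) = 3"
  proof -
    have "CHAR('a) dvd 3 ^ m" using CHAR_dvd_CARD[where ?'a = 'a] assms(3) by simp
    moreover have "prime CHAR('a)"
      by (rule prime_CHAR_semidom) (rule finite_imp_CHAR_pos, simp)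
    ultimately have "CHAR('a) dvd 3" using prime_dvd_power by blast
    then show ?thesis using \<open>prime CHAR('a)\<close> by (simp add: primes_dvd_imp_eq)
  qed
  note \<alpha> = generates_units_inj_on[OF assms(4), folded n_def]
  have Fermat: "x ^ n = 1" if "x \<noteq> 0" for x :: 'a
    using power_card_units[OF that] by (simp add: n_def)
  have qq: "(x ^ q) ^ q = x" for x :: 'a
  proof -
    have "(x ^ q) ^ q = x ^ Suc n" using card q3 by (simp add: n_def flip: power_mult)
    then show ?thesis using Fermat[of x] by (cases "x = 0") simp_all
  qed
  have pow_m: "x ^ 3 ^ m = x" for x :: 'a
    using qq[of x] card assms(3) by (simp flip: power_mult)

  \<comment> \<open>The cube of \<open>\<beta>\<close> as an inverse norm\<close>
  define \<gamma> where "\<gamma> = inverse (\<alpha> * \<alpha> ^ q)"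
  have \<gamma>: "\<beta> ^ 3 = \<gamma>"
  proof -
    \<comment> \<open>Since 3e = 2q^2 - q - 3 and n = q^2 - 1. Working with 3e turns the powers of 3
      in \<open>e\<close> into \<open>q\<close> and \<open>q * q\<close>.\<close>
    have "e * 3 + int (q + 1) = int (2 * n)"
    proof -
      have "m = Suc (m - 1)" using assms(1) by simp
      then have "3 * 3 ^ (m - 1) = int (q * q)"
        using card assms(3) by (metis of_nat_numeral of_nat_power power_Suc)
      moreover have "3 * 3 ^ (h - 1) = int q"
        using \<open>q = 3 * 3 ^ (h - 1)\<close> by simp
      moreover have "int n = int (q * q) - 1" using card q3 by (simp add: n_def of_nat_diff)
      ultimately show ?thesis unfolding assms(5) h_def[symmetric] by simp
    qed
    then have "\<alpha> powi (e * 3 + int (q + 1)) = 1"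
      using Fermat[OF \<alpha>(1)] by (simp add: power_int_of_nat power_mult mult.commute[of 2] del: of_nat_mult)
    moreover have "\<alpha> powi (e * 3 + int (q + 1)) = \<beta> ^ 3 * (\<alpha> * \<alpha> ^ q)"
      using \<alpha>(1) by (subst power_int_add) (simp_all add: \<beta>_def power_int_mult power_int_add)
    ultimately have "\<beta> ^ 3 * (\<alpha> * \<alpha> ^ q) = 1" by simp
    then show ?thesis using \<alpha>(1) by (simp add: \<gamma>_def field_simps)
  qed
  have \<beta>_nz: "\<beta> \<noteq> 0" using \<alpha>(1) by (simp add: \<beta>_def)
  \<comment> \<open>The inverse of \<open>\<gamma>\<close> is \<open>\<alpha> ^ (q + 1)\<close>, and
    the exponents \<open>(q + 1) * i\<close> stay below
    \<open>n = (q + 1) * (q - 1)\<close>.\<close>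
  have \<gamma>_inj: "i = j" if "\<gamma> ^ i = \<gamma> ^ j" "i < q - 1" "j < q - 1" for i j
  proof -
    have "\<alpha> ^ ((q + 1) * l) = inverse (\<gamma> ^ l)" for l
      unfolding \<gamma>_def power_mult power_inverse by simp
    then have "\<alpha> ^ ((q + 1) * i) = \<alpha> ^ ((q + 1) * j)" using that(1) by simp
    moreover have "(q + 1) * i < n" "(q + 1) * j < n"
      unfolding n using that(2,3) by (intro mult_strict_left_mono; simp)+
    ultimately have "(q + 1) * i = (q + 1) * j" using inj_onD[OF \<alpha>(2)] by simp
    then show ?thesis by (simp only: mult_cancel1) simp
  qed
  have cube_inj: "x = y" if "x ^ 3 = y ^ 3" for x y :: 'a
  proof -
    have "3 ^ m = (3 :: nat) * 3 ^ (m - 1)" using assms(1) by (metis Suc_diff_1 power_Suc)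
    then have "x = (x ^ 3) ^ 3 ^ (m - 1)" for x :: 'a
      using pow_m[of x] by (simp flip: power_mult)
    then show ?thesis using that by metis
  qed
  \<comment> \<open>It suffices to compare cubes: the norm is fixed by the q-power map, which swaps
    its two factors.\<close>
  have \<beta>_pow: "\<beta> ^ 3 ^ h = \<beta>"
  proof (rule cube_inj)
    have "(\<beta> ^ 3 ^ h) ^ 3 = \<gamma> ^ q"
      by (simp add: q_def \<gamma>[symmetric] mult.commute flip: power_mult)
    also have "\<dots> = inverse (\<alpha> ^ q * (\<alpha> ^ q) ^ q)"
      by (simp only: \<gamma>_def power_inverse power_mult_distrib)
    also have "\<dots> = \<beta> ^ 3" unfolding qq \<gamma> by (simp add: \<gamma>_def mult.commute)
    finally show "(\<beta> ^ 3 ^ h) ^ 3 = \<beta> ^ 3" .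
  qed

  \<comment> \<open>Minimal polynomials of the three zeros and their degrees\<close>
  define X :: "gf3 poly" where "X = Polynomial.monom 1 n - 1"
  have X_nz: "X \<noteq> 0" unfolding X_def using monom_minus_1_properties(2) hn by simp
  have root: "gf3_eval x X = 0" if "x \<noteq> 0" for x :: 'a
  proof -
    interpret E: comm_ring_hom "gf3_eval x" using char by (rule comm_ring_hom_gf3_eval)
    show ?thesis
      using Fermat[OF that] by (simp add: X_def E.hom_minus gf3_eval_monom[OF char] gf3_embed_def)
  qed
  define A B \<Gamma> where "A = minimal_poly (1 :: 'a)" and "B = minimal_poly \<alpha>" and "\<Gamma> = minimal_poly \<beta>"
  note wit1 = char X_nz root[of 1, OF one_neq_zero]
  note wit\<alpha> = char X_nz root[OF \<alpha>(1)]
  note wit\<beta> = char X_nz root[OF \<beta>_nz]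
  have monic: "lead_coeff A = 1" "lead_coeff B = 1" "lead_coeff \<Gamma> = 1"
    unfolding A_def B_def \<Gamma>_def
    by (rule lead_coeff_minimal_poly[OF wit1] lead_coeff_minimal_poly[OF wit\<alpha>]
        lead_coeff_minimal_poly[OF wit\<beta>])+
  then have nz: "A \<noteq> 0" "B \<noteq> 0" "\<Gamma> \<noteq> 0" by auto
  have degA: "Polynomial.degree A = 1"
    unfolding A_def by (rule degree_minimal_poly[OF char, where S = "{0, 1}"]) auto
  have degB: "Polynomial.degree B = m"
    unfolding B_def
  proof (rule degree_minimal_poly[OF char assms(1) pow_m, where S = "insert 0 ((\<lambda>i. \<alpha> ^ i) ` {..<n})"])
    have "card (insert 0 ((\<lambda>i. \<alpha> ^ i) ` {..<n})) = Suc n"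
      using \<alpha>(1) by (subst card_insert_disjoint) (auto simp: card_image[OF \<alpha>(2)])
    also have "\<dots> = 3 ^ m" using assms(3) by (simp add: n_def)
    finally show "3 ^ (m - 1) < card (insert 0 ((\<lambda>i. \<alpha> ^ i) ` {..<n}))"
      using assms(1) by simp
  qed auto
  have deg\<Gamma>: "Polynomial.degree \<Gamma> = h"
    unfolding \<Gamma>_def
  \<comment> \<open>Powers of \<open>\<gamma>\<close> are powers of \<open>\<beta>\<close> with
    exponents divisible by 3; together with 0 they give \<open>q\<close> elements.\<close>
  proof (rule degree_minimal_poly[OF char h \<beta>_pow, where S = "insert 0 ((\<lambda>i. \<gamma> ^ i) ` {..<q - 1})"])
    have "inj_on (\<lambda>i. \<gamma> ^ i) {..<q - 1}" using \<gamma>_inj by (auto intro!: inj_onI)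
    moreover have "\<gamma> \<noteq> 0" using \<alpha>(1) by (simp add: \<gamma>_def)
    ultimately have "card (insert 0 ((\<lambda>i. \<gamma> ^ i) ` {..<q - 1})) = Suc (q - 1)"
      by (subst card_insert_disjoint) (auto simp: card_image)
    also have "\<dots> = 3 ^ h" using q3 by (simp add: q_def)
    finally show "3 ^ (h - 1) < card (insert 0 ((\<lambda>i. \<gamma> ^ i) ` {..<q - 1}))"
      using h by simp
  qed (auto simp flip: \<gamma> power_mult)

  \<comment> \<open>Coprimality of the three factors\<close>
  have "coprime B A"
    unfolding B_def
  proof (rule prime_elem_imp_coprime[OF prime_elem_minimal_poly[OF wit\<alpha>]], fold B_def)
    show "\<not> B dvd A" using dvd_imp_degree_le[OF _ nz(1)] degA degB m h by fastforce
  qed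
  moreover have "coprime B \<Gamma>"
    unfolding B_def
  proof (rule prime_elem_imp_coprime[OF prime_elem_minimal_poly[OF wit\<alpha>]], fold B_def)
    show "\<not> B dvd \<Gamma>" using dvd_imp_degree_le[OF _ nz(3)] deg\<Gamma> degB m h by fastforce
  qed
  \<comment> \<open>Degrees settle the two cases with \<open>B\<close>, but here both are 1 when
    \<open>h = 1\<close>. The roots are compared instead: divisibility would force
    \<open>\<beta> = 1\<close>.\<close>
  moreover have "coprime \<Gamma> A"
    unfolding \<Gamma>_def
  proof (rule prime_elem_imp_coprime[OF prime_elem_minimal_poly[OF wit\<beta>]], fold \<Gamma>_def, rule notI)
    assume "\<Gamma> dvd A"
    define L :: "gf3 poly" where "L = Polynomial.monom 1 1 - 1"
    have L: "gf3_eval x L = x - 1" for x :: 'a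
    proof -
      interpret E: comm_ring_hom "gf3_eval x" using char by (rule comm_ring_hom_gf3_eval)
      show ?thesis by (simp add: L_def E.hom_minus gf3_eval_monom[OF char] gf3_embed_def)
    qed
    have "A dvd L" unfolding A_def minimal_poly_dvd_iff[OF wit1] by (simp add: L)
    with \<open>\<Gamma> dvd A\<close> have "\<Gamma> dvd L" by (rule dvd_trans)
    then have "\<beta> = 1" unfolding \<Gamma>_def minimal_poly_dvd_iff[OF wit\<beta>] by (simp add: L)
    then have "\<gamma> = 1" using \<gamma> by simp
    moreover have "0 < q - 1" "1 < q - 1" using q3 by simp_all
    ultimately show False using \<gamma>_inj[of 0 1] by simp
  qed
  ultimately have cops: "coprime B \<Gamma>" "coprime A (B * \<Gamma>)"
    by (simp_all add: coprime_commute)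

  define g where "g = A * (B * \<Gamma>)"
  have "A dvd X" "B dvd X" "\<Gamma> dvd X"
    unfolding A_def B_def \<Gamma>_def
    by (simp_all add: minimal_poly_dvd_iff[OF wit1] minimal_poly_dvd_iff[OF wit\<alpha>]
        minimal_poly_dvd_iff[OF wit\<beta>] root \<alpha>(1) \<beta>_nz)
  then have gX: "g dvd X" unfolding g_def by (meson divides_mult cops)
  have g_monic: "lead_coeff g = 1" using monic by (simp add: g_def lead_coeff_mult)
  then have g_nz: "g \<noteq> 0" by auto
  have deg_g: "Polynomial.degree g = 3 * h + 1"
    using nz degA degB deg\<Gamma> m by (simp add: g_def degree_mult_eq)
  have g_prod: "g = (\<Prod>i\<leftarrow>[0, 1, e]. minimal_poly (\<alpha> powi i))"
    by (simp add: g_def A_def B_def \<Gamma>_def \<beta>_def)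
  define C where "C = generated_code n g"
  have n_pos: "n > 0" using hn by simp
  have C_eq: "cyclic_code_of \<alpha> [0, 1, e] = C"
    using n_pos cop g_monic gX unfolding C_def g_prod X_def n_def
    by (rule cyclic_code_of_eq)
  have cyclic: "cyclic_code n C"
    unfolding C_def using generated_code_cyclic(1)[OF n_pos cop g_monic] gX by (simp add: X_def)
  define k where "k = n - (3 * h + 1)"
  \<comment> \<open>\<open>3 * m div 2\<close> equals \<open>3 * h\<close>, and one unit of the 2
    passes into \<open>n = 3 ^ m - 1\<close>.\<close>
  have k_eq: "3 ^ m - 3 * m div 2 - 2 = k"
    using n_eq hn by (simp add: k_def m)
  have card_C: "card C = 3 ^ k"
    by (simp add: C_def card_generated_code[OF g_nz] deg_g k_def)
  have sub_C: "VectorSpace.subspace class_ring C (module_vec TYPE(gf3) n)"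
    unfolding C_def by (rule subspace_generated_code)
  have dim_C: "vectorspace.dim class_ring ((module_vec TYPE(gf3) n)\<lparr>carrier := C\<rparr>) = k"
    using card_subspace[OF sub_C] card_C by simp

  \<comment> \<open>Upper bound for every code of this length and dimension\<close>
  have upper: "d' \<le> 4" if D: "linear_code n k d' D" for D d'
  proof -
    have sub: "VectorSpace.subspace class_ring D (module_vec TYPE(gf3) n)"
      and dim: "vectorspace.dim class_ring ((module_vec TYPE(gf3) n)\<lparr>carrier := D\<rparr>) = k"
      and d': "min_dist D = d'" using D by (auto simp: linear_code_def)
    have "n = k + (3 * h + 1)" using hn by (simp add: k_def)
    then have "3 ^ n = 3 ^ k * (3 :: nat) ^ (3 * h + 1)" by (metis power_add)
    also have "(3 :: nat) ^ (3 * h + 1) = 3 * q ^ 3"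
      by (simp add: q_def mult.commute flip: power_mult)
    also have "3 ^ k * (3 * q ^ 3) < 3 ^ k * (2 * n * (n - 1))"
      using square_bounds[OF q3] by (simp add: n_def card)
    finally have "3 ^ n < card D * (2 * n * (n - 1))"
      using card_subspace[OF sub] by (simp add: dim)
    moreover have "D \<subseteq> carrier_vec n"
      using submodule.subset sub by (fastforce simp: VectorSpace.subspace_def module_vec_simps)
    ultimately show ?thesis using min_dist_le_4 d' by blast
  qed

  \<comment> \<open>Lower bound for the code itself\<close>
  have "0 < k" using hn by (simp add: k_def)
  then have "1 < card C" unfolding card_C by (intro one_less_power) simp_all
  then obtain c d where cd: "c \<in> C" "d \<in> C" "c \<noteq> d"
    by (metis One_nat_def card.infinite card_le_Suc0_iff_eq less_Suc_eq_le not_less_eq zero_le)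
  have "4 \<le> min_dist C"
  proof (rule min_dist_geI[OF cd])
    fix x y assume xy: "x \<in> C" "y \<in> C" "x \<noteq> y"
    then have carr: "x \<in> carrier_vec n" "y \<in> carrier_vec n" by (auto simp: C_def generated_code_def)
    define u where "u = x - y"
    have u: "u \<in> carrier_vec n" using carr by (simp add: u_def)
    have u_nz: "u \<noteq> 0\<^sub>v n"
    proof
      assume "u = 0\<^sub>v n"
      have "x $ i = y $ i" if "i < n" for i
        using arg_cong[OF \<open>u = 0\<^sub>v n\<close>, of "\<lambda>v. v $ i"] carr that by (simp add: u_def)
      then have "x = y" using carr by (intro eq_vecI) auto
      with xy(3) show False ..
    qed
    have "g dvd word_poly u"
      using xy by (auto simp: u_def word_poly_minus[OF carr] C_def generated_code_def)
    then have "A dvd word_poly u" "B dvd word_poly u" "\<Gamma> dvd word_poly u"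
      unfolding g_def by (auto dest: dvd_mult_left dvd_mult_right)
    then have eval: "gf3_eval 1 (word_poly u) = (0::'a)" "gf3_eval \<alpha> (word_poly u) = 0"
      "gf3_eval \<beta> (word_poly u) = 0"
      unfolding A_def B_def \<Gamma>_def
      by (simp_all add: minimal_poly_dvd_iff[OF wit1] minimal_poly_dvd_iff[OF wit\<alpha>]
          minimal_poly_dvd_iff[OF wit\<beta>])
    \<comment> \<open>Cubing the value at \<open>\<beta>\<close> evaluates at
      \<open>\<beta> ^ 3\<close>.\<close>
    have "gf3_eval \<gamma> (word_poly u) = 0"
      using gf3_eval_power[OF char, of \<beta> "word_poly u" 1] eval(3) \<gamma> by simp
    then have "4 \<le> card {i. i < n \<and> u $ i \<noteq> 0}"
      using weight_ge_4[OF char q_def qq \<alpha> u u_nz eval(1,2)] by (simp add: \<gamma>_def)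
    also have "{i. i < n \<and> u $ i \<noteq> 0} = {i. i < dim_vec x \<and> x $ i \<noteq> y $ i}"
      using carr by (auto simp: u_def)
    finally show "4 \<le> hamming_dist x y" by (simp add: hamming_dist_def)
  qed
  moreover have "linear_code n k (min_dist C) C"
    using sub_C dim_C by (simp add: linear_code_def)
  \<comment> \<open>The upper bound applies to \<open>C\<close> itself and pins its minimum distance
    to 4.\<close>
  ultimately have "linear_code n k 4 C"
    using upper by (metis order_antisym)
  then show ?thesis
    unfolding C_eq n_eq k_eq optimal_code_def using cyclic upper by blast
qed

end
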